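(* Let $r\in\mathbb{Z}$. Then the following equality holds in $\mathbb{Z}\llbracket x,y\rrbracket$ (in particular, both sides have integer coefficients): $$1+\sum_{n\geq1}\sum_{\sigma\in S_{n}}\frac{y^{n}}{n!}\det(I_{n}-xM_{\sigma})^{r}=\prod_{k\geq0}(1-yx^{k})^{-\binom{k-r-1}{k}}.$$
   Context: $\mathbb{Z}\llbracket x,y\rrbracket$ is the ring of formal power series in $x,y$ with integer coefficients. $S_n$ is the symmetric group on $n$ letters, $M_\sigma$ is the $n\times n$ permutation matrix of $\sigma\in S_n$, and $I_n$ is the $n\times n$ identity matrix. The polynomial $\det(I_n-xM_\sigma)$ has constant term $1$, so it is invertible as a formal power series in $x$ and its $r$-th power makes sense for every integer $r$. Binomial numbers are defined by $\binom{a}{k}=\frac{a(a-1)\cdots(a-k+1)}{k!}$ for all integers $a$ and $k\ge 0$, with $\binom{a}{0}=1$. The infinite product is understood as a (convergent) product of formal power series. *)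

theory Defs
  imports
    "HOL-Computational_Algebra.Formal_Power_Series"
    "HOL-Combinatorics.Permutations"
    "Jordan_Normal_Form.Determinant"
begin

text \<open>
  The ring \<open>R[[x,y]]\<close> is represented as \<open>(R[[x]])[[y]]\<close>, that is, by the type \<open>'a fps fps\<close>: the
  outer variable is \<open>y\<close>, the inner one is \<open>x\<close>, and \<open>fps_nth (fps_nth F i) j\<close> is the coefficient of
  \<open>y^i x^j\<close> in \<open>F\<close>.
\<close>

definition of_x :: "'a::zero fps \<Rightarrow> 'a fps fps" where
  "of_x f = fps_const f"

definition var_x :: "'a::{zero,one} fps fps" where
  "var_x = of_x fps_X"

definition var_y :: "'a::{zero,one} fps fps" where
  "var_y = fps_X"

definition scalar :: "'a::zero \<Rightarrow> 'a fps fps" where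
  "scalar c = of_x (fps_const c)"

definition of_int_fps2 :: "int fps fps \<Rightarrow> 'a::ring_1 fps fps" where
  "of_int_fps2 F = Abs_fps (\<lambda>i. Abs_fps (\<lambda>j. of_int (fps_nth (fps_nth F i) j)))"

text \<open>
  Convergence of formal power series in two variables: each coefficient is eventually constant.
  The library metric on \<open>'a fps fps\<close> is not used because it is the \<open>y\<close>-adic one, for which
  \<open>\<Prod>k. (1 - y x^k)^e\<^sub>k\<close> does not converge.
\<close>

definition fps2_tendsto :: "(nat \<Rightarrow> 'a fps fps) \<Rightarrow> 'a::zero fps fps \<Rightarrow> bool" where
  "fps2_tendsto S F \<longleftrightarrow>
    (\<forall>i j. eventually (\<lambda>N. fps_nth (fps_nth (S N) i) j = fps_nth (fps_nth F i) j) sequentially)"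

lemma fps2_tendsto_unique:
  assumes "fps2_tendsto S F" and "fps2_tendsto S G"
  shows "F = G"
proof -
  have "fps_nth (fps_nth F i) j = fps_nth (fps_nth G i) j" for i j
  proof -
    have "eventually (\<lambda>N. fps_nth (fps_nth F i) j = fps_nth (fps_nth G i) j) sequentially"
      using assms[unfolded fps2_tendsto_def, rule_format, of i j] by eventually_elim simp
    then show ?thesis by simp
  qed
  then show ?thesis by (simp add: fps_eq_iff)
qed

text \<open>
  Negative powers use the library \<open>inverse\<close>; the next lemma confirms that on nested power series
  over a field it is the actual inverse whenever the constant term is nonzero.
\<close>

lemma fps2_inverse:
  fixes F :: "'a::field fps fps"
  assumes "fps_nth (fps_nth F 0) 0 \<noteq> 0"
  shows "F * inverse F = 1"
proof -
  have "fps_nth F 0 * inverse (fps_nth F 0) = 1"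
    using assms by (rule inverse_mult_eq_1')
  then show ?thesis
    unfolding fps_inverse_def[of F] by (rule fps_right_inverse)
qed

text \<open>
  Binomial numbers \<open>a (a-1) ... (a-k+1) / k!\<close> with an integer upper argument, which are integers;
  by the lemma below the \<open>div\<close> is exact. This is the library's \<open>a gchoose k\<close> on \<open>int\<close>, whose syntax is
  restricted to fields unless the imports happen to restore the more general sort constraint.
\<close>

definition int_binomial :: "int \<Rightarrow> nat \<Rightarrow> int" where
  "int_binomial a k = (\<Prod>i = 0..<k. a - int i) div fact k"

lemma of_int_int_binomial:
  "of_int (int_binomial a k) = (of_int a gchoose k :: 'a::field_char_0)"
  unfolding int_binomial_def gbinomial_prod_rev[where 'a = int, symmetric] by (rule of_int_gbinomial)

definition permutation_mat :: "nat \<Rightarrow> (nat \<Rightarrow> nat) \<Rightarrow> 'a::{zero,one} mat" where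
  "permutation_mat n \<sigma> = mat n n (\<lambda>(i, j). if i = \<sigma> j then 1 else 0)"

definition det_one_minus_x :: "nat \<Rightarrow> (nat \<Rightarrow> nat) \<Rightarrow> 'a::comm_ring_1 fps" where
  "det_one_minus_x n \<sigma> = det (1\<^sub>m n - fps_X \<cdot>\<^sub>m permutation_mat n \<sigma>)"

end

theory Submission
  imports Defs
begin

text \<open>
  Both sides are determined by their \<open>y\<close>-coefficients \<open>A\<^sub>n\<close>, which satisfy \<open>A\<^sub>0 = 1\<close> and
  \<open>(n + 1) A\<^bsub>n+1\<^esub> = (\<Sum>k\<le>n. (1 - x^(k+1))^r A\<^bsub>n-k\<^esub>)\<close>.

  On the product side this is the logarithmic derivative in \<open>y\<close>, together with
  \<open>(\<Sum>k. b\<^sub>k x^(k m)) = (1 - x^m)^r\<close> for the exponents \<open>b\<^sub>k = (-1)^k (r choose k)\<close>.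

  On the permutation side \<open>k + 1\<close> is the length of the cycle of a marked point. Cycles are avoided
  by giving every row of the permutation matrix its own weight: eliminating the last index of
  \<open>det (I - diag(u) M\<^sub>\<sigma>)\<close> either splits off a factor \<open>1 - u\<^sub>n\<close> or merges the weight \<open>u\<^sub>n\<close> into that of
  the image of \<open>n\<close>. With all weights \<open>x\<close> except \<open>x^m\<close> at the marked point, which by conjugation
  invariance may always be taken to be the last one, this gives a recursion in \<open>n\<close> and \<open>m\<close>.
\<close>

no_notation vec_index (infixl \<open>$\<close> 100)
unbundle fps_syntax

section \<open>Determinants of weighted permutation matrices\<close>

text \<open>For a permutation \<open>\<sigma>\<close> of \<open>{..<n}\<close> the determinant is
  the product, over the cycles of \<open>\<sigma>\<close>, of 1 minus the product of the weights on
  the cycle. This explains why merging neighbours on a cycle multiplies their weights.\<close>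

definition weighted_mat :: "nat \<Rightarrow> (nat \<Rightarrow> nat) \<Rightarrow> (nat \<Rightarrow> 'a) \<Rightarrow> 'a::comm_ring_1 mat" where
  "weighted_mat n \<sigma> u =
    mat n n (\<lambda>(i, j). (if i = j then 1 else 0) - (if i = \<sigma> j then u i else 0))"

lemma weighted_mat_carrier [simp]: "weighted_mat n \<sigma> u \<in> carrier_mat n n"
  by (simp add: weighted_mat_def)

text \<open>Since \<open>n\<close> is a fixed point, the matrix is block diagonal with last entry
  \<open>1 - u n\<close>.\<close>

lemma det_weighted_mat_fixed:
  fixes u :: "nat \<Rightarrow> 'a::idom"
  assumes "\<sigma> permutes {..<n}"
  shows "det (weighted_mat (Suc n) \<sigma> u) = (1 - u n) * det (weighted_mat n \<sigma> u)"
proof -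
  have n_fixed: "\<sigma> n = n"
    using assms by (simp add: permutes_not_in)
  have "\<sigma> j < n" if "j < n" for j
    using permutes_in_image[OF assms, of j] that by simp
  then have neq: "n \<noteq> \<sigma> j" if "j < n" for j
    using that by fastforce
  have "weighted_mat (Suc n) \<sigma> u =
    four_block_mat (weighted_mat n \<sigma> u) (0\<^sub>m n 1) (0\<^sub>m 1 n) (mat 1 1 (\<lambda>_. 1 - u n))"
    (is "?L = ?R")
  proof (rule eq_matI)
    fix k l assume "k < dim_row ?R" "l < dim_col ?R"
    then show "?L $$ (k, l) = ?R $$ (k, l)"
      using n_fixed neq[of l] by (auto simp: weighted_mat_def less_Suc_eq)
  qed (auto simp: weighted_mat_def)
  then show ?thesis
    by (simp add: det_four_block_mat_lower_left_zero[of _ n _ 1] det_single)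
qed

text \<open>
  Adding \<open>u n\<close> times column \<open>n\<close> to the column of the predecessor of \<open>n\<close> clears row \<open>n\<close> up to the
  diagonal entry, and merges the weight of \<open>n\<close> into that of its image \<open>i\<close>.
\<close>

lemma det_weighted_mat_insert:
  fixes u :: "nat \<Rightarrow> 'a::idom"
  assumes "\<sigma> permutes {..<n}" and "i < n"
  shows "det (weighted_mat (Suc n) (transpose n i \<circ> \<sigma>) u) =
    det (weighted_mat n \<sigma> (u(i := u i * u n)))"
proof -
  have n_fixed: "\<sigma> n = n"
    using assms by (simp add: permutes_not_in)
  have lt: "\<sigma> j < n" if "j < n" for j
    using permutes_in_image[OF assms(1), of j] that by simp
  \<comment> \<open>\<open>j0\<close> is the predecessor of \<open>i\<close> under
    \<open>\<sigma>\<close>, hence the predecessor of \<open>n\<close> under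
    \<open>transpose n i \<circ> \<sigma>\<close>.\<close>
  define j0 where "j0 = inv_into UNIV \<sigma> i"
  have j0: "\<sigma> j = i \<longleftrightarrow> j = j0" for j
    using assms(1) by (metis j0_def permutes_inverses)
  have "j0 < n"
    using n_fixed j0 lt assms
    by (metis j0_def lessThan_iff permutes_in_image permutes_inv)
  have image: "(transpose n i \<circ> \<sigma>) j = (if j = n then i else if j = j0 then n else \<sigma> j)"
    if "j < Suc n" for j
  proof -
    have "j < n \<Longrightarrow> \<sigma> j \<noteq> n"
      using lt by fastforce
    then show ?thesis
      using that n_fixed j0[of j] \<open>j0 < n\<close> by (auto simp: transpose_def less_Suc_eq)
  qed
  have "addcol (u n) j0 n (weighted_mat (Suc n) (transpose n i \<circ> \<sigma>) u) =
    four_block_mat (weighted_mat n \<sigma> (u(i := u i * u n)))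
      (mat n 1 (\<lambda>(k, _). if k = i then - u i else 0)) (0\<^sub>m 1 n) (1\<^sub>m 1)" (is "?L = ?R")
  proof (rule eq_matI)
    fix k l assume "k < dim_row ?R" "l < dim_col ?R"
    then have kl: "k < Suc n" "l < Suc n"
      by (auto simp: weighted_mat_def)
    define B where "B l = (if k = l then 1 else 0) -
      (if k = (if l = n then i else if l = j0 then n else \<sigma> l) then u k else 0)" for l
    have B: "weighted_mat (Suc n) (transpose n i \<circ> \<sigma>) u $$ (k, l) = B l" if "l < Suc n" for l
      using kl that by (simp add: weighted_mat_def B_def image del: comp_apply)
    have L: "?L $$ (k, l) = (if l = j0 then u n * B n else 0) + B l"
      using kl B[of n] B[of l] by (auto simp: weighted_mat_def mat_addcol_def)
    have R: "?R $$ (k, l) = (if k = n then if l = n then 1 else 0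
      else if l = n then if k = i then - u i else 0
      else (if k = l then 1 else 0) - (if k = \<sigma> l then if k = i then u i * u n else u k else 0))"
      using kl by (auto simp: weighted_mat_def)
    have ne: "n \<noteq> i" "j0 \<noteq> n"
      using \<open>i < n\<close> \<open>j0 < n\<close> by auto
    show "?L $$ (k, l) = ?R $$ (k, l)"
    proof (cases "l = n")
      case True
      then show ?thesis
        unfolding L R B_def using ne by auto
    next
      case False
      then have "\<sigma> l \<noteq> n"
        using kl lt[of l] by simp
      show ?thesis
      proof (cases "l = j0")
        case True
        have "\<sigma> l = i"
          using True j0 by blast
        then show ?thesis
          unfolding L R B_def using \<open>l \<noteq> n\<close> True ne by (auto split: if_splits)
      next
        case False
        have "\<sigma> l \<noteq> i"
          using False j0 by blast
        then show ?thesis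
          unfolding L R B_def using \<open>l \<noteq> n\<close> False \<open>\<sigma> l \<noteq> n\<close> ne
          by (cases "k = \<sigma> l"; cases "k = i"; cases "k = n") simp_all
      qed
    qed
  qed (auto simp: weighted_mat_def)
  then have "det (addcol (u n) j0 n (weighted_mat (Suc n) (transpose n i \<circ> \<sigma>) u)) =
    det (weighted_mat n \<sigma> (u(i := u i * u n)))"
    by (simp add: det_four_block_mat_lower_left_zero[of _ n _ 1])
  then show ?thesis
    using \<open>j0 < n\<close> by (simp add: det_addcol[of n "Suc n"])
qed

text \<open>Conjugation renames row and column indices alike, so the sign of \<open>\<pi>\<close>
  enters twice and cancels.\<close>

lemma det_weighted_mat_conjugate:
  fixes u :: "nat \<Rightarrow> 'a::comm_ring_1"
  assumes "\<sigma> permutes {..<n}" and "\<pi> permutes {..<n}"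
  shows "det (weighted_mat n (inv_into UNIV \<pi> \<circ> \<sigma> \<circ> \<pi>) (u \<circ> \<pi>)) = det (weighted_mat n \<sigma> u)"
proof -
  let ?A = "weighted_mat n \<sigma> u"
  \<comment> \<open>The columns are permuted first, as rows of the transpose; the rows follow after
    transposing back.\<close>
  let ?C = "mat n n (\<lambda>(i, j). ?A\<^sup>T $$ (\<pi> i, j))"
  have \<pi>: "\<pi> permutes {0..<n}"
    using assms(2) by (simp add: lessThan_atLeast0)
  have lt: "\<pi> j < n" if "j < n" for j
    using permutes_in_image[OF assms(2), of j] that by simp
  have conj: "i = inv_into UNIV \<pi> (\<sigma> (\<pi> j)) \<longleftrightarrow> \<pi> i = \<sigma> (\<pi> j)" for i j
    using assms(2) by (metis permutes_inverses)
  have inj: "\<pi> i = \<pi> j \<longleftrightarrow> i = j" for i j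
    using permutes_inj[OF assms(2)] by (simp add: inj_eq)
  have "weighted_mat n (inv_into UNIV \<pi> \<circ> \<sigma> \<circ> \<pi>) (u \<circ> \<pi>) = mat n n (\<lambda>(i, j). ?C\<^sup>T $$ (\<pi> i, j))"
    by (rule eq_matI) (auto simp: weighted_mat_def lt conj inj)
  also have "det \<dots> = signof \<pi> * det (?C\<^sup>T)"
    by (rule det_permute_rows) (simp_all add: \<pi>)
  also have "det (?C\<^sup>T) = det ?C"
    by (rule det_transpose[of _ n]) simp
  also have "det ?C = signof \<pi> * det (?A\<^sup>T)"
    by (rule det_permute_rows) (simp_all add: \<pi>)
  also have "det (?A\<^sup>T) = det ?A"
    by (rule det_transpose[of _ n]) simp
  finally show ?thesis
    by (simp add: sign_def comp_def)
qed

section \<open>Recursions for sums over the symmetric group\<close>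

text \<open>\<open>\<phi>\<close> stands for the \<open>r\<close>-th power; the recursions rest on
  its multiplicativity.\<close>

definition perm_sum ::
  "('a::idom \<Rightarrow> 'b::comm_ring_1) \<Rightarrow> nat \<Rightarrow> (nat \<Rightarrow> 'a) \<Rightarrow> 'b" where
  "perm_sum \<phi> n u = (\<Sum>\<sigma> | \<sigma> permutes {..<n}. \<phi> (det (weighted_mat n \<sigma> u)))"

lemma perm_sum_0: "perm_sum \<phi> 0 u = \<phi> 1"
  by (simp add: perm_sum_def weighted_mat_def)

text \<open>Each permutation of \<open>{..<Suc n}\<close> is uniquely
  \<open>transpose n i \<circ> \<sigma>\<close> with \<open>i \<le> n\<close> and
  \<open>\<sigma>\<close> fixing \<open>n\<close>. The case \<open>i = n\<close> splits off a
  factor, the others merge weights.\<close>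

lemma perm_sum_Suc:
  assumes "\<And>a b. \<phi> (a * b) = \<phi> a * \<phi> b"
  shows "perm_sum \<phi> (Suc n) u =
    \<phi> (1 - u n) * perm_sum \<phi> n u + (\<Sum>i<n. perm_sum \<phi> n (u(i := u i * u n)))"
proof -
  have "perm_sum \<phi> (Suc n) u = (\<Sum>i\<in>insert n {..<n}. \<Sum>\<sigma> | \<sigma> permutes {..<n}.
      \<phi> (det (weighted_mat (Suc n) (transpose n i \<circ> \<sigma>) u)))"
    unfolding perm_sum_def lessThan_Suc by (rule sum_over_permutations_insert) auto
  also have "\<dots> = (\<Sum>\<sigma> | \<sigma> permutes {..<n}. \<phi> (det (weighted_mat (Suc n) \<sigma> u))) +
    (\<Sum>i<n. \<Sum>\<sigma> | \<sigma> permutes {..<n}. \<phi> (det (weighted_mat (Suc n) (transpose n i \<circ> \<sigma>) u)))"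
    by simp
  also have "\<dots> = \<phi> (1 - u n) * perm_sum \<phi> n u + (\<Sum>i<n. perm_sum \<phi> n (u(i := u i * u n)))"
    unfolding perm_sum_def sum_distrib_left
    by (intro arg_cong2[of _ _ _ _ "(+)"] sum.cong refl)
      (simp_all add: det_weighted_mat_fixed det_weighted_mat_insert assms)
  finally show ?thesis .
qed

text \<open>Conjugation by \<open>\<pi>\<close> is a bijection of the summation range.\<close>

lemma perm_sum_permute:
  assumes "\<pi> permutes {..<n}"
  shows "perm_sum \<phi> n (u \<circ> \<pi>) = perm_sum \<phi> n u"
proof -
  have bij: "bij_betw (\<lambda>\<sigma>. inv_into UNIV \<pi> \<circ> \<sigma> \<circ> \<pi>) {\<sigma>. \<sigma> permutes {..<n}} {\<sigma>. \<sigma> permutes {..<n}}"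
    by (rule bij_betwI[where g = "\<lambda>\<sigma>. \<pi> \<circ> \<sigma> \<circ> inv_into UNIV \<pi>"])
      (use assms in \<open>auto intro!: permutes_compose permutes_inv simp: fun_eq_iff permutes_inverses\<close>)
  have "perm_sum \<phi> n (u \<circ> \<pi>) = (\<Sum>\<sigma> | \<sigma> permutes {..<n}.
      \<phi> (det (weighted_mat n (inv_into UNIV \<pi> \<circ> \<sigma> \<circ> \<pi>) (u \<circ> \<pi>))))"
    unfolding perm_sum_def by (rule sum.reindex_bij_betw[OF bij, symmetric])
  also have "\<dots> = perm_sum \<phi> n u"
    unfolding perm_sum_def
    by (intro sum.cong refl arg_cong[of _ _ \<phi>] det_weighted_mat_conjugate) (simp_all add: assms)
  finally show ?thesis .
qed

lemma perm_sum_cong: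
  "(\<And>i. i < n \<Longrightarrow> u i = v i) \<Longrightarrow> perm_sum \<phi> n u = perm_sum \<phi> n v"
proof -
  assume "\<And>i. i < n \<Longrightarrow> u i = v i"
  then have "weighted_mat n \<sigma> u = weighted_mat n \<sigma> v" for \<sigma>
    by (intro eq_matI) (auto simp: weighted_mat_def)
  then show ?thesis
    by (simp add: perm_sum_def)
qed

text \<open>Eliminating the marked point \<open>Suc n\<close> either closes its cycle or merges it
  into one of the \<open>Suc n\<close> other points, and all these merges contribute
  equally.\<close>

lemma perm_sum_distinguished_Suc:
  assumes "\<And>a b. \<phi> (a * b) = \<phi> a * \<phi> b"
  shows "perm_sum \<phi> (Suc (Suc n)) ((\<lambda>_. x)(Suc n := x ^ m)) =
    \<phi> (1 - x ^ m) * perm_sum \<phi> (Suc n) (\<lambda>_. x) +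
    of_nat (Suc n) * perm_sum \<phi> (Suc n) ((\<lambda>_. x)(n := x ^ Suc m))"
proof -
  let ?u = "(\<lambda>_. x)(Suc n := x ^ m)"
  have "perm_sum \<phi> (Suc n) (?u(i := ?u i * ?u (Suc n))) =
      perm_sum \<phi> (Suc n) ((\<lambda>_. x)(n := x ^ Suc m))" if "i < Suc n" for i
  proof -
    \<comment> \<open>The merged weight \<open>x * x ^ m\<close> sits at \<open>i\<close>; a
      transposition moves it to the last index \<open>n\<close>.\<close>
    have "perm_sum \<phi> (Suc n) ((\<lambda>_. x)(n := x ^ Suc m)) =
      perm_sum \<phi> (Suc n) ((\<lambda>_. x)(n := x ^ Suc m) \<circ> transpose i n)"
      using that by (intro perm_sum_permute[symmetric] permutes_swap_id) auto
    also have "\<dots> = perm_sum \<phi> (Suc n) (?u(i := ?u i * ?u (Suc n)))"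
      using that by (intro perm_sum_cong) (auto simp: transpose_def)
    finally show ?thesis ..
  qed
  moreover have "perm_sum \<phi> (Suc n) ?u = perm_sum \<phi> (Suc n) (\<lambda>_. x)"
    by (rule perm_sum_cong) simp
  ultimately show ?thesis
    by (subst perm_sum_Suc[of \<phi>, OF assms]) simp
qed

text \<open>Unrolls the previous recursion: \<open>k\<close> counts the merges before the cycle of
  the marked point closes. The exponent \<open>m\<close> grows along the way, so it is generalized
  in the induction.\<close>

lemma perm_sum_distinguished:
  fixes \<phi> :: "'b::idom \<Rightarrow> 'a::field_char_0 fps"
  assumes "\<And>a b. \<phi> (a * b) = \<phi> a * \<phi> b"
  shows "fps_const (1 / fact n) * perm_sum \<phi> (Suc n) ((\<lambda>_. x)(n := x ^ m)) =
    (\<Sum>k\<le>n. \<phi> (1 - x ^ (m + k)) * (fps_const (1 / fact (n - k)) * perm_sum \<phi> (n - k) (\<lambda>_. x)))"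
proof (induction n arbitrary: m)
  case 0
  show ?case
    by (simp add: perm_sum_Suc[of \<phi>, OF assms] perm_sum_0)
next
  case (Suc n)
  \<comment> \<open>The number \<open>Suc n\<close> of equal merges is absorbed by the
    factorial.\<close>
  have "fps_const (1 / fact (Suc n)) * of_nat (Suc n) = (fps_const (1 / fact n) :: 'a fps)"
    by (simp del: of_nat_Suc add: fps_of_nat [symmetric] divide_simps)
  then have "fps_const (1 / fact (Suc n)) * perm_sum \<phi> (Suc (Suc n)) ((\<lambda>_. x)(Suc n := x ^ m)) =
    \<phi> (1 - x ^ m) * (fps_const (1 / fact (Suc n)) * perm_sum \<phi> (Suc n) (\<lambda>_. x)) +
    fps_const (1 / fact n) * perm_sum \<phi> (Suc n) ((\<lambda>_. x)(n := x ^ Suc m))"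
    unfolding perm_sum_distinguished_Suc[of \<phi>, OF assms]
    by (simp only: distrib_left mult.assoc[symmetric]) (simp only: mult_ac)
  also have "\<dots> = (\<Sum>k\<le>Suc n. \<phi> (1 - x ^ (m + k)) *
      (fps_const (1 / fact (Suc n - k)) * perm_sum \<phi> (Suc n - k) (\<lambda>_. x)))"
    unfolding Suc.IH sum.atMost_Suc_shift by (simp del: fact_Suc)
  finally show ?case .
qed

text \<open>This is the case \<open>m = 1\<close>, where the marked point has the same weight as all
  others.\<close>

lemma perm_sum_recurrence:
  fixes \<phi> :: "'b::idom \<Rightarrow> 'a::field_char_0 fps" and x :: 'b
  assumes "\<And>a b. \<phi> (a * b) = \<phi> a * \<phi> b"
  defines "A \<equiv> \<lambda>n. fps_const (1 / fact n) * perm_sum \<phi> n (\<lambda>_. x)"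
  shows "of_nat (Suc n) * A (Suc n) = (\<Sum>k\<le>n. \<phi> (1 - x ^ Suc k) * A (n - k))"
proof -
  have "of_nat (Suc n) * fps_const (1 / fact (Suc n)) = (fps_const (1 / fact n) :: 'a fps)"
    by (simp del: of_nat_Suc add: fps_of_nat [symmetric] divide_simps)
  moreover have "(\<lambda>_. x)(n := x ^ 1) = (\<lambda>_. x)"
    by auto
  ultimately show ?thesis
    using perm_sum_distinguished[of \<phi>, OF assms(1), of n x 1]
    unfolding A_def mult.assoc[symmetric] by simp
qed

section \<open>Integer powers and the binomial series\<close>

lemma fps_power_int_mult:
  "(f * g :: 'a::field fps) powi r = f powi r * g powi r"
  by (simp add: power_int_def fps_inverse_mult power_mult_distrib)

lemma fps_power_int_compose:
  fixes f c :: "'a::field fps"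
  assumes "f $ 0 \<noteq> 0" and "c $ 0 = 0"
  shows "(f powi r) oo c = (f oo c) powi r"
  by (simp add: power_int_def fps_compose_power[symmetric] fps_inverse_compose assms)

lemma fps_binomial_of_int:
  "fps_binomial (of_int r) = ((1 + fps_X) powi r :: 'a::field_char_0 fps)"
proof (cases r rule: int_cases2)
  case (nonneg n)
  then show ?thesis
    by (simp add: fps_binomial_of_nat)
next
  case (nonpos n)
  then show ?thesis
    by (cases "n = 0") (simp_all add: fps_binomial_minus_of_nat power_int_def fps_inverse_power)
qed

text \<open>Substitutes \<open>- (fps_X ^ m)\<close> into the binomial series of
  \<open>(1 + fps_X) powi r\<close>. Upper negation absorbs the sign \<open>(-1) ^ k\<close> and
  produces the exponents of the product.\<close>

lemma one_minus_X_power_powi_nth: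
  assumes "m > 0" and "j < N"
  shows "((1 - fps_X ^ m) powi r) $ j =
    ((\<Sum>k<N. of_int (int_binomial (int k - r - 1) k) * fps_X ^ (k * m)) :: 'a::field_char_0 fps) $ j"
proof -
  have X0: "(- (fps_X ^ m) :: 'a fps) $ 0 = 0"
    using assms by simp
  have "(1 - fps_X ^ m :: 'a fps) = (1 + fps_X) oo (- (fps_X ^ m))"
    using X0 by (simp add: fps_compose_add_distrib)
  then have "(1 - fps_X ^ m :: 'a fps) powi r = fps_binomial (of_int r) oo (- (fps_X ^ m))"
    using X0 by (simp add: fps_power_int_compose fps_binomial_of_int)
  also have "\<dots> $ j = (\<Sum>k = 0..j. (of_int r gchoose k) * ((- (fps_X ^ m)) ^ k :: 'a fps) $ j)"
    by (simp add: fps_compose_nth)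
  also have "\<dots> = (\<Sum>k = 0..j. of_int (int_binomial (int k - r - 1) k) * (fps_X ^ (k * m) :: 'a fps) $ j)"
  proof (rule sum.cong)
    fix k
    have "(- (fps_X ^ m)) ^ k = (fps_const ((-1) ^ k) * fps_X ^ (k * m) :: 'a fps)"
      by (subst power_minus)
        (simp add: power_mult[symmetric] mult.commute fps_const_power[symmetric]
          fps_const_neg[symmetric] del: fps_const_neg fps_const_power)
    then show "(of_int r gchoose k) * ((- (fps_X ^ m)) ^ k) $ j =
        of_int (int_binomial (int k - r - 1) k) * (fps_X ^ (k * m) :: 'a fps) $ j"
      by (simp add: gbinomial_negated_upper[of "of_int r"] of_int_int_binomial
          del: fps_X_power_nth)
  qed simp
  also have "\<dots> = (\<Sum>k<N. of_int (int_binomial (int k - r - 1) k) * (fps_X ^ (k * m) :: 'a fps) $ j)"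
  proof (rule sum.mono_neutral_left)
    show "\<forall>k\<in>{..<N} - {0..j}.
        of_int (int_binomial (int k - r - 1) k) * (fps_X ^ (k * m) :: 'a fps) $ j = 0"
    proof
      \<comment> \<open>As \<open>m \<ge> 1\<close>, the order \<open>k * m\<close> of the term is
        at least \<open>k\<close>, which exceeds \<open>j\<close>.\<close>
      fix k assume "k \<in> {..<N} - {0..j}"
      then have "j < k * m"
        using assms(1) by (metis DiffD2 atLeastAtMost_iff le0 less_le_trans linorder_not_le
            mult.right_neutral mult_le_mono2 less_one)
      then show "of_int (int_binomial (int k - r - 1) k) * (fps_X ^ (k * m) :: 'a fps) $ j = 0"
        by simp
    qed
  qed (use assms in auto)
  finally show ?thesis
    by (simp add: fps_sum_nth fps_of_int[symmetric] del: fps_X_power_nth)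
qed

section \<open>Logarithmic derivative of the product\<close>

text \<open>The inverse of \<open>1 - u y\<close>, given by its coefficients so that both the
  recurrence and integrality can be read off.\<close>

definition geometric_fps :: "'a::comm_ring_1 \<Rightarrow> 'a fps" where
  "geometric_fps u = Abs_fps (\<lambda>n. u ^ n)"

lemma geometric_fps_right_inverse:
  "(1 - fps_X * fps_const u) * geometric_fps u = 1"
proof (rule fps_ext)
  fix n
  show "((1 - fps_X * fps_const u) * geometric_fps u) $ n = 1 $ n"
    by (cases n) (simp_all add: left_diff_distrib mult.assoc geometric_fps_def)
qed

text \<open>The coefficient ring \<open>'a fps\<close> is not a field, so \<open>inverse\<close> is
  first shown to be a true inverse by \<open>fps2_inverse\<close>; uniqueness of inverses does the
  rest.\<close>

lemma inverse_one_minus_X: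
  fixes u :: "'a::field fps"
  shows "inverse (1 - fps_X * fps_const u) = geometric_fps u"
proof -
  let ?F = "1 - fps_X * fps_const u"
  have "inverse ?F = inverse ?F * (?F * geometric_fps u)"
    by (simp only: geometric_fps_right_inverse mult_1_right)
  also have "\<dots> = (?F * inverse ?F) * geometric_fps u"
    by (simp only: mult_ac)
  also have "?F * inverse ?F = 1"
    by (rule fps2_inverse) simp
  finally show ?thesis
    by simp
qed

lemma fps_deriv_geometric:
  "fps_deriv (geometric_fps u) = fps_const u * geometric_fps u * geometric_fps u"
proof -
  let ?F = "1 - fps_X * fps_const u" and ?G = "geometric_fps u"
  \<comment> \<open>Differentiate \<open>?F * ?G = 1\<close> and multiply by
    \<open>?G\<close>.\<close>
  have "0 = fps_deriv (?F * ?G) * ?G"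
    by (simp add: geometric_fps_right_inverse)
  also have "\<dots> = fps_deriv ?G * (?F * ?G) - fps_const u * ?G * ?G"
    by (simp add: algebra_simps)
  finally show ?thesis
    by (simp add: geometric_fps_right_inverse)
qed

text \<open>The logarithmic derivative of \<open>(1 - u y)^(-b)\<close> is
  \<open>b u / (1 - u y)\<close>, stated without division. For \<open>b \<ge> 0\<close> the power is
  one of the geometric series, for \<open>b \<le> 0\<close> a polynomial.\<close>

lemma fps_deriv_one_minus_X_powi:
  fixes u :: "'a::field fps"
  shows "fps_deriv ((1 - fps_X * fps_const u) powi (- b)) =
    of_int b * fps_const u * geometric_fps u * (1 - fps_X * fps_const u) powi (- b)"
proof (cases b rule: int_cases2)
  case (nonneg n)
  then have "(1 - fps_X * fps_const u) powi (- b) = geometric_fps u ^ n"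
    by (cases "n = 0") (simp_all add: power_int_def inverse_one_minus_X)
  then show ?thesis
    using nonneg
    by (cases n) (simp_all add: fps_deriv_power' fps_deriv_geometric mult_ac del: power_Suc,
        simp add: mult_ac)
next
  case (nonpos n)
  then have "(1 - fps_X * fps_const u) powi (- b) = (1 - fps_X * fps_const u) ^ n"
    by simp
  moreover have "fps_deriv ((1 - fps_X * fps_const u) ^ n) =
      of_int b * fps_const u * geometric_fps u * (1 - fps_X * fps_const u) ^ n"
  proof (cases n)
    case 0
    then show ?thesis
      using nonpos by simp
  next
    case (Suc m)
    \<comment> \<open>One factor \<open>1 - u y\<close> cancels against the geometric
      series.\<close>
    have "of_int b * fps_const u * geometric_fps u * (1 - fps_X * fps_const u) ^ n =
        of_int b * fps_const u * (1 - fps_X * fps_const u) ^ m *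
          ((1 - fps_X * fps_const u) * geometric_fps u)"
      unfolding Suc power_Suc by (simp only: mult_ac)
    also have "\<dots> = fps_deriv ((1 - fps_X * fps_const u) ^ n)"
      unfolding geometric_fps_right_inverse
      using nonpos Suc by (simp add: fps_deriv_power' fps_const_neg[symmetric]
        del: power_Suc fps_const_neg of_nat_Suc)
    finally show ?thesis ..
  qed
  ultimately show ?thesis
    by simp
qed

lemma fps_deriv_prod_one_minus_X_powi:
  fixes u :: "nat \<Rightarrow> 'a::field fps"
  shows "fps_deriv (\<Prod>k<N. (1 - fps_X * fps_const (u k)) powi (- b k)) =
    (\<Sum>k<N. of_int (b k) * fps_const (u k) * geometric_fps (u k)) *
    (\<Prod>k<N. (1 - fps_X * fps_const (u k)) powi (- b k))"
proof (induction N)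
  case (Suc N)
  show ?case
    unfolding prod.lessThan_Suc sum.lessThan_Suc fps_deriv_mult fps_deriv_one_minus_X_powi Suc.IH
    by (simp only: distrib_left distrib_right mult_ac add.commute)
qed simp

text \<open>Compares the coefficients of \<open>y^n\<close> in the logarithmic derivative identity;
  that of \<open>b u / (1 - u y)\<close> at \<open>y^i\<close> is \<open>b u^(i+1)\<close>.\<close>

lemma prod_one_minus_X_powi_recurrence:
  fixes u :: "nat \<Rightarrow> 'a::field fps" and b :: "nat \<Rightarrow> int"
  defines "P \<equiv> \<lambda>N. \<Prod>k<N. (1 - fps_X * fps_const (u k)) powi (- b k)"
  shows "of_nat (Suc n) * P N $ Suc n =
    (\<Sum>i\<le>n. (\<Sum>k<N. of_int (b k) * u k ^ Suc i) * P N $ (n - i))"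
proof -
  have coeff: "(of_int c * fps_const v * geometric_fps v) $ i = of_int c * v ^ Suc i"
    for c i and v :: "'a fps"
    by (simp add: fps_of_int[symmetric] geometric_fps_def mult.assoc)
  have "of_nat (Suc n) * P N $ Suc n = fps_deriv (P N) $ n"
    by simp
  also have "\<dots> = (\<Sum>i = 0..n.
      (\<Sum>k<N. of_int (b k) * fps_const (u k) * geometric_fps (u k)) $ i * P N $ (n - i))"
    unfolding P_def fps_deriv_prod_one_minus_X_powi by (rule fps_mult_nth)
  finally show ?thesis
    by (simp only: fps_sum_nth coeff atMost_atLeast0)
qed

section \<open>Comparing recurrences modulo a power of \<open>x\<close>\<close>

text \<open>A finite product has the right recurrence only modulo \<open>x^N\<close>. This suffices:
  coefficient \<open>j\<close> of a product involves only coefficients up to \<open>j\<close>, and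
  \<open>Suc n\<close> can be cancelled in characteristic zero.\<close>

lemma recurrence_determines_truncation:
  fixes A B g h :: "nat \<Rightarrow> 'a::field_char_0 fps"
  assumes A: "\<And>n. of_nat (Suc n) * A (Suc n) = (\<Sum>i\<le>n. g i * A (n - i))"
    and B: "\<And>n. of_nat (Suc n) * B (Suc n) = (\<Sum>i\<le>n. h i * B (n - i))"
    and 0: "A 0 = B 0"
    and gh: "\<And>i j. j < N \<Longrightarrow> g i $ j = h i $ j"
    and "j < N"
  shows "A n $ j = B n $ j"
  using \<open>j < N\<close>
proof (induction n arbitrary: j rule: less_induct)
  case (less n)
  show ?case
  proof (cases n)
    case 0
    then show ?thesis
      using assms(3) by simp
  next
    case (Suc m)
    have "of_nat (Suc m) * A (Suc m) $ j = (of_nat (Suc m) * A (Suc m)) $ j"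
      by (simp del: of_nat_Suc add: fps_of_nat[symmetric])
    also have "\<dots> = (of_nat (Suc m) * B (Suc m)) $ j"
      unfolding A B fps_sum_nth fps_mult_nth
      using less by (intro sum.cong refl arg_cong2[of _ _ _ _ "(*)"]) (auto simp: gh Suc)
    also have "\<dots> = of_nat (Suc m) * B (Suc m) $ j"
      by (simp del: of_nat_Suc add: fps_of_nat[symmetric])
    finally show ?thesis
      by (simp del: of_nat_Suc add: Suc)
  qed
qed

section \<open>Integrality of the product\<close>

definition integral_coeffs :: "'a::comm_ring_1 fps fps \<Rightarrow> bool" where
  "integral_coeffs F \<longleftrightarrow> (\<forall>i j. F $ i $ j \<in> \<int>)"

lemma integral_coeffs_1: "integral_coeffs 1"
  by (simp add: integral_coeffs_def)

lemma integral_coeffs_mult: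
  "integral_coeffs F \<Longrightarrow> integral_coeffs G \<Longrightarrow> integral_coeffs (F * G)"
  by (auto simp: integral_coeffs_def fps_mult_nth fps_sum_nth intro!: Ints_sum Ints_mult)

lemma integral_coeffs_power: "integral_coeffs F \<Longrightarrow> integral_coeffs (F ^ n)"
  by (induction n) (simp_all add: integral_coeffs_1 integral_coeffs_mult)

lemma integral_coeffs_prod:
  "(\<And>k. k \<in> K \<Longrightarrow> integral_coeffs (F k)) \<Longrightarrow> integral_coeffs (\<Prod>k\<in>K. F k)"
  by (induction K rule: infinite_finite_induct)
    (simp_all add: integral_coeffs_1 integral_coeffs_mult)

text \<open>Both \<open>1 - y x^k\<close> and its inverse, a geometric series, have integer
  coefficients.\<close>

lemma integral_coeffs_one_minus_X_powi:
  "integral_coeffs ((1 - fps_X * fps_const (fps_X ^ k) :: 'a::field fps fps) powi m)"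
proof -
  have "integral_coeffs (1 - fps_X * fps_const (fps_X ^ k) :: 'a fps fps)"
    by (auto simp: integral_coeffs_def)
  moreover have "integral_coeffs (geometric_fps (fps_X ^ k) :: 'a fps fps)"
    by (auto simp: integral_coeffs_def geometric_fps_def simp flip: power_mult)
  ultimately show ?thesis
    by (auto simp: power_int_def inverse_one_minus_X intro: integral_coeffs_power)
qed

section \<open>Identification of the two sides\<close>

lemma det_one_minus_x_eq: "det_one_minus_x n \<sigma> = det (weighted_mat n \<sigma> (\<lambda>_. fps_X))"
  unfolding det_one_minus_x_def
  by (intro arg_cong[of _ _ det] eq_matI) (auto simp: weighted_mat_def permutation_mat_def)

lemma one_minus_var_y_var_x: "1 - var_y * var_x ^ k = 1 - fps_X * fps_const (fps_X ^ k)"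
  by (simp add: var_y_def var_x_def of_x_def)

lemma perm_series_coeff:
  assumes "i \<le> N"
  shows "(1 + (\<Sum>n = 1..N. \<Sum>\<sigma> | \<sigma> permutes {..<n}.
      scalar (1 / fact n) * var_y ^ n * of_x (det_one_minus_x n \<sigma> powi r))) $ i =
    (fps_const (1 / fact i) * perm_sum (\<lambda>f. f powi r) i (\<lambda>_. fps_X) :: 'a::field_char_0 fps)"
proof -
  let ?A = "\<lambda>n. fps_const (1 / fact n) * perm_sum (\<lambda>f. f powi r) n (\<lambda>_. fps_X) :: 'a fps"
  have monomial: "(scalar c * var_y ^ n * of_x d) $ i = (if n = i then fps_const c * d else 0)"
    for c n and d :: "'a fps"
    by (simp add: scalar_def of_x_def var_y_def)
  have "(\<Sum>\<sigma> | \<sigma> permutes {..<n}.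
      scalar (1 / fact n) * var_y ^ n * of_x (det_one_minus_x n \<sigma> powi r)) $ i =
      (if n = i then ?A n else 0)" for n
    by (simp add: fps_sum_nth monomial perm_sum_def sum_distrib_left det_one_minus_x_eq)
  then have "(1 + (\<Sum>n = 1..N. \<Sum>\<sigma> | \<sigma> permutes {..<n}.
      scalar (1 / fact n) * var_y ^ n * of_x (det_one_minus_x n \<sigma> powi r))) $ i =
      1 $ i + (\<Sum>n = 1..N. if n = i then ?A n else 0)"
    by (simp add: fps_sum_nth)
  \<comment> \<open>The leading 1 supplies the term \<open>n = 0\<close>, which the sum
    omits.\<close>
  also have "\<dots> = ?A i"
    using assms by (cases "i = 0") (auto simp: perm_sum_0 power_int_def)
  finally show ?thesis .
qed

text \<open>Both sequences start at 1 and, with \<open>u k = x^k\<close>, satisfy the same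
  recurrence modulo \<open>x^N\<close>.\<close>

lemma perm_sum_eq_product_coeff:
  assumes "j < N"
  shows "(fps_const (1 / fact i) * perm_sum (\<lambda>f. f powi r) i (\<lambda>_. fps_X) :: 'a::field_char_0 fps) $ j =
    (\<Prod>k<N. (1 - var_y * var_x ^ k) powi (- int_binomial (int k - r - 1) k)) $ i $ j"
proof -
  let ?b = "\<lambda>k. int_binomial (int k - r - 1) k"
  let ?A = "\<lambda>n. fps_const (1 / fact n) * perm_sum (\<lambda>f. f powi r) n (\<lambda>_. fps_X) :: 'a fps"
  let ?P = "\<Prod>k<N. (1 - fps_X * fps_const (fps_X ^ k) :: 'a fps fps) powi (- ?b k)"
  have "?A i $ j = ?P $ i $ j"
  proof (rule recurrence_determines_truncation[where A = ?A and B = "fps_nth ?P" and N = N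
        and g = "\<lambda>i. (1 - fps_X ^ Suc i) powi r"
        and h = "\<lambda>i. \<Sum>k<N. of_int (?b k) * (fps_X ^ k) ^ Suc i"])
    fix n
    show "of_nat (Suc n) * ?A (Suc n) = (\<Sum>i\<le>n. (1 - fps_X ^ Suc i) powi r * ?A (n - i))"
      by (rule perm_sum_recurrence[where \<phi> = "\<lambda>f. f powi r"]) (rule fps_power_int_mult)
    show "of_nat (Suc n) * ?P $ Suc n =
      (\<Sum>i\<le>n. (\<Sum>k<N. of_int (?b k) * (fps_X ^ k) ^ Suc i) * ?P $ (n - i))"
      by (rule prod_one_minus_X_powi_recurrence)
  next
    have "((1 - fps_X * fps_const (fps_X ^ k) :: 'a fps fps) powi (- m)) $ 0 = 1" for k m
      by (simp add: power_int_def inverse_one_minus_X fps_nth_power_0 geometric_fps_def)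
    then have "?P $ 0 = 1"
      by (induction N) simp_all
    then show "?A 0 = ?P $ 0"
      by (simp add: perm_sum_0 power_int_def)
  next
    fix i j assume "j < N"
    then show "((1 - fps_X ^ Suc i) powi r :: 'a fps) $ j =
        (\<Sum>k<N. of_int (?b k) * (fps_X ^ k) ^ Suc i) $ j"
      unfolding power_mult[symmetric] by (intro one_minus_X_power_powi_nth) simp_all
  next
    show "j < N" by (rule assms)
  qed
  then show ?thesis
    by (simp only: one_minus_var_y_var_x)
qed

theorem theorem1p1:
  fixes r :: int
  shows "\<exists>F :: int fps fps.
    fps2_tendsto
      (\<lambda>N. 1 + (\<Sum>n = 1..N. \<Sum>\<sigma> | \<sigma> permutes {..<n}.
         scalar (1 / fact n) * var_y ^ n * of_x (det_one_minus_x n \<sigma> powi r)))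
      (of_int_fps2 F :: rat fps fps) \<and>
    fps2_tendsto
      (\<lambda>N. \<Prod>k<N. (1 - var_y * var_x ^ k) powi (- int_binomial (int k - r - 1) k))
      (of_int_fps2 F :: rat fps fps)"
proof -
  define A :: "nat \<Rightarrow> rat fps" where
    "A n = fps_const (1 / fact n) * perm_sum (\<lambda>f. f powi r) n (\<lambda>_. fps_X)" for n
  \<comment> \<open>The floor only changes the type: the entries of \<open>A\<close> turn out to be
    integers.\<close>
  define F :: "int fps fps" where
    "F = Abs_fps (\<lambda>i. Abs_fps (\<lambda>j. \<lfloor>A i $ j\<rfloor>))"
  have prod: "A i $ j =
      (\<Prod>k<N. (1 - var_y * var_x ^ k) powi (- int_binomial (int k - r - 1) k)) $ i $ j"
    if "j < N" for i j N
    unfolding A_def using that by (rule perm_sum_eq_product_coeff)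
  have "A i $ j \<in> \<int>" for i j
  proof -
    \<comment> \<open>Integrality is hidden by \<open>1 / fact n\<close> on the permutation side but
      visible in the product; \<open>Suc j\<close> factors determine the coefficients of
      \<open>x^j\<close>.\<close>
    have "integral_coeffs (\<Prod>k<Suc j.
        (1 - var_y * var_x ^ k :: rat fps fps) powi (- int_binomial (int k - r - 1) k))"
      unfolding one_minus_var_y_var_x
      by (intro integral_coeffs_prod integral_coeffs_one_minus_X_powi)
    then show ?thesis
      unfolding prod[OF lessI[of j]] integral_coeffs_def by blast
  qed
  then have F: "of_int_fps2 F $ i $ j = A i $ j" for i j
    by (simp add: of_int_fps2_def F_def)
  show ?thesis
  proof (intro exI[of _ F] conjI)
    show "fps2_tendsto (\<lambda>N. 1 + (\<Sum>n = 1..N. \<Sum>\<sigma> | \<sigma> permutes {..<n}.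
        scalar (1 / fact n) * var_y ^ n * of_x (det_one_minus_x n \<sigma> powi r)))
      (of_int_fps2 F :: rat fps fps)"
      unfolding fps2_tendsto_def F A_def
    proof (intro allI)
      fix i j
      show "\<forall>\<^sub>F N in sequentially. (1 + (\<Sum>n = 1..N. \<Sum>\<sigma> | \<sigma> permutes {..<n}.
          scalar (1 / fact n) * var_y ^ n * of_x (det_one_minus_x n \<sigma> powi r))) $ i $ j =
        (fps_const (1 / fact i) * perm_sum (\<lambda>f. f powi r) i (\<lambda>_. fps_X) :: rat fps) $ j"
        by (rule eventually_sequentiallyI[of i]) (simp only: perm_series_coeff)
    qed
    show "fps2_tendsto
      (\<lambda>N. \<Prod>k<N. (1 - var_y * var_x ^ k) powi (- int_binomial (int k - r - 1) k))
      (of_int_fps2 F :: rat fps fps)"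
      unfolding fps2_tendsto_def F
    proof (intro allI)
      fix i j
      show "\<forall>\<^sub>F N in sequentially.
        (\<Prod>k<N. (1 - var_y * var_x ^ k) powi (- int_binomial (int k - r - 1) k)) $ i $ j = A i $ j"
        by (rule eventually_sequentiallyI[of "Suc j"]) (simp only: prod Suc_le_eq)
    qed
  qed
qed

end
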